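(* The maximum values $f^+(n,\delta)$ and minimum values $f^-(n,\delta)$ satisfy the following, as $n \to \infty$. (a) For each $0<\delta<1$ there are constants $c_1(\delta)$ and $c_2(\delta)$ such that \[0< c_1(\delta) < \left( \frac{f^+(n,\delta)}{n!} \right)^{1/n} < c_2(\delta) <1 \quad \mbox{ for } n \mbox{ sufficiently large};\] and further, $c_1(\delta) \to 1$ as $\delta \to 0$, and $c_2(\delta) \to 0$ as $\delta \to 1$. (b) For each $0<\delta<1$ there are constants $c_3(\delta)$ and $c_4(\delta)$ such that \[1 < c_3(\delta) < f^-(n,\delta)^{1/n} < c_4(\delta) < \infty \quad \mbox{ for } n \mbox{ sufficiently large};\] and further, $c_3(\delta) \to \infty$ as $\delta \to 0$, and $c_4(\delta) \to 1$ as $\delta \to 1$.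
   Context: For a finite poset $Q_n$ on $n$ points, $e(Q_n)$ denotes its number of linear extensions and $\mathrm{comp}(Q_n)$ denotes the number of edges in its comparability graph (the number of comparable pairs). For a positive integer $n$ and $0<\delta<1$, \[ f^+(n,\delta)= \max \left\{ e(Q_n): \mathrm{comp}(Q_n) \geq \delta \binom{n}{2} \right\}, \quad f^-(n,\delta)= \min \left\{ e(Q_n): \mathrm{comp}(Q_n) \leq \delta \binom{n}{2} \right\}. \] *)

theory Defs
  imports Complex_Main
begin

definition linear_extensions :: "'a set \<Rightarrow> 'a rel \<Rightarrow> 'a rel set" where
  "linear_extensions A r = {l. linear_order_on A l \<and> r \<subseteq> l}"

definition num_linear_extensions :: "'a set \<Rightarrow> 'a rel \<Rightarrow> nat" where
  "num_linear_extensions A r = card (linear_extensions A r)"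

definition comparability_edges :: "'a rel \<Rightarrow> 'a set set" where
  "comparability_edges r = {{x, y} | x y. x \<noteq> y \<and> (x, y) \<in> r}"

definition num_comparable_pairs :: "'a rel \<Rightarrow> nat" where
  "num_comparable_pairs r = card (comparability_edges r)"

text \<open>
  Both counts are invariant under isomorphism, so the posets on \<open>n\<close> points are represented by
  the (reflexive) partial orders on the fixed ground set \<open>{..<n}\<close>. The sets below are finite,
  and nonempty for \<open>0 < \<delta> < 1\<close>, so \<open>Max\<close> and \<open>Min\<close> are genuine there.
\<close>

definition f_plus :: "nat \<Rightarrow> real \<Rightarrow> nat" where
  "f_plus n \<delta> = Max {num_linear_extensions {..<n} r | r.
     partial_order_on {..<n} r \<and> real (num_comparable_pairs r) \<ge> \<delta> * real (n choose 2)}"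

definition f_minus :: "nat \<Rightarrow> real \<Rightarrow> nat" where
  "f_minus n \<delta> = Min {num_linear_extensions {..<n} r | r.
     partial_order_on {..<n} r \<and> real (num_comparable_pairs r) \<le> \<delta> * real (n choose 2)}"

lemma finite_poset_values:
  fixes n :: nat
  shows "finite {num_linear_extensions {..<n} r | r. partial_order_on {..<n} r \<and> P r}"
proof -
  have "{num_linear_extensions {..<n} r | r. partial_order_on {..<n} r \<and> P r}
        \<subseteq> num_linear_extensions {..<n} ` Pow ({..<n} \<times> {..<n})"
    by (auto simp: order_on_defs)
  then show ?thesis
    by (rule finite_subset) simp
qed

lemma f_plus_set_nonempty:
  assumes "\<delta> \<le> 1"
  shows "{num_linear_extensions {..<n} r | r. partial_order_on {..<n} r \<and>
            real (num_comparable_pairs r) \<ge> \<delta> * real (n choose 2)} \<noteq> {}"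
proof -
  define r where "r = {(x, y). x \<le> y \<and> y < n}"
  have po: "partial_order_on {..<n} r"
    by (auto simp: r_def order_on_defs refl_on_def trans_def antisym_def)
  have "comparability_edges r = {e. e \<subseteq> {..<n} \<and> card e = 2}"
  proof (intro equalityI subsetI)
    fix e assume "e \<in> comparability_edges r"
    then show "e \<in> {e. e \<subseteq> {..<n} \<and> card e = 2}"
      by (auto simp: comparability_edges_def r_def)
  next
    fix e assume "e \<in> {e. e \<subseteq> {..<n} \<and> card e = 2}"
    then obtain x y where "e = {x, y}" "x \<noteq> y" "x < n" "y < n"
      by (auto simp: card_2_iff)
    then show "e \<in> comparability_edges r"
      unfolding comparability_edges_def r_def
      by (cases "x \<le> y") (auto, metis insert_commute nat_le_linear)
  qed
  then have "num_comparable_pairs r = n choose 2"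
    by (simp add: num_comparable_pairs_def n_subsets)
  with po assms show ?thesis
    by (auto intro!: exI[of _ r] simp: mult_le_cancel_right2)
qed

lemma f_minus_set_nonempty:
  assumes "\<delta> \<ge> 0"
  shows "{num_linear_extensions {..<n} r | r. partial_order_on {..<n} r \<and>
            real (num_comparable_pairs r) \<le> \<delta> * real (n choose 2)} \<noteq> {}"
proof -
  have "partial_order_on {..<n} (Id_on {..<n})"
    by (auto simp: order_on_defs refl_on_def trans_def antisym_def)
  moreover have "comparability_edges (Id_on {..<n}) = {}"
    by (auto simp: comparability_edges_def)
  ultimately show ?thesis
    using assms by (auto intro!: exI[of _ "Id_on {..<n}"] simp: num_comparable_pairs_def)
qed

end

theory Submission
  imports Defs "HOL-Real_Asymp.Real_Asymp"
begin

text \<open>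
  Removing the greatest element of a linear extension gives, by induction, two dual estimates:
  a partition into chains \<open>C\<^sub>i\<close> yields \<open>e(Q) \<le> n! / \<Prod> |C\<^sub>i|!\<close>, and a partition into levels \<open>A\<^sub>i\<close>
  along a strictly monotone function yields \<open>e(Q) \<ge> \<Prod> |A\<^sub>i|!\<close>.

  If at most \<open>\<epsilon> (n choose 2)\<close> pairs are incomparable (comparable), an antichain (chain) has size at
  most \<open>\<surd>\<epsilon> n + 1\<close>, so by Dilworth (Mirsky) the poset splits into that many chains (antichains), and
  \<open>\<Prod> k\<^sub>i!\<close> is then at least \<open>\<phi>(\<epsilon>)\<^sup>n\<close> with \<open>\<phi>(\<epsilon>) > 1\<close> and \<open>\<phi>(\<epsilon>) \<rightarrow> \<infinity>\<close> as \<open>\<epsilon> \<rightarrow> 0\<close>. This gives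
  \<open>c\<^sub>2(\<delta>) = 1 / \<phi>(1 - \<delta>)\<close> and \<open>c\<^sub>3(\<delta>) = \<phi>(\<delta>)\<close>.

  For the other two bounds, cut the points into consecutive blocks of size about \<open>(1 - \<epsilon>) n\<close>. The
  ordered sum of antichains and the disjoint union of chains on these blocks are extremal for the two
  estimates, and weighting the \<open>i\<close>-th block by \<open>\<epsilon>\<^sup>i\<close> bounds the multinomial coefficient by \<open>\<psi>(\<epsilon>)\<^sup>n\<close>
  with \<open>\<psi>(\<epsilon>) \<rightarrow> 1\<close> as \<open>\<epsilon> \<rightarrow> 0\<close>. This gives \<open>c\<^sub>1(\<delta>) = 1 / \<psi>(\<delta>)\<close> and \<open>c\<^sub>4(\<delta>) = \<psi>(1 - \<delta>)\<close>.
\<close>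

subsection \<open>Counting linear extensions by their greatest element\<close>

lemma finite_linear_extensions:
  assumes "finite A"
  shows "finite (linear_extensions A r)"
proof (rule finite_subset)
  show "linear_extensions A r \<subseteq> Pow (A \<times> A)"
    by (auto simp: linear_extensions_def order_on_defs)
qed (use assms in simp)

text \<open>\<open>B\<close> runs through subsets of a fixed carrier \<open>A\<close>, so the
  induction adds points without ever restricting \<open>l\<close>.\<close>

lemma linear_order_on_has_greatest:
  assumes "finite B" "B \<noteq> {}" "B \<subseteq> A" "linear_order_on A l"
  shows "\<exists>x\<in>B. \<forall>y\<in>B. (y, x) \<in> l"
  using assms
proof (induction B rule: finite_ne_induct)
  case (singleton x)
  then show ?case by (auto simp: order_on_defs refl_on_def)
next
  case (insert z B)
  then obtain x where x: "x \<in> B" "\<forall>y\<in>B. (y, x) \<in> l" by auto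
  have l: "refl_on A l" "trans l" "total_on A l" using insert.prems by (auto simp: order_on_defs)
  have "z \<in> A" "x \<in> A" "z \<noteq> x" using insert x by auto
  then consider "(x, z) \<in> l" | "(z, x) \<in> l" using l by (auto simp: total_on_def)
  then show ?case
  proof cases
    case 1
    then have "\<forall>y\<in>insert z B. (y, z) \<in> l" using x l \<open>z \<in> A\<close> by (auto simp: refl_on_def dest: transD)
    then show ?thesis by blast
  qed (use x in auto)
qed

text \<open>The greatest point \<open>x\<close> of a linear extension is maximal for
  \<open>r\<close>; conversely, any maximal \<open>x\<close> can be put on top of an extension of
  the rest, and \<open>A \<times> {x}\<close> is what that adds, reflexive pair included. Writing
  \<open>Restr r A\<close> with \<open>r\<close> fixed lets later inductions shrink only
  \<open>A\<close>.\<close>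

lemma linear_extensions_remove_greatest:
  assumes "finite A" "A \<noteq> {}"
  shows "linear_extensions A (Restr r A) =
    (\<Union>x\<in>{x\<in>A. \<forall>y\<in>A. (x, y) \<in> r \<longrightarrow> y = x}.
       (\<lambda>l. l \<union> A \<times> {x}) ` linear_extensions (A - {x}) (Restr r (A - {x})))" (is "?L = ?R")
proof (intro equalityI subsetI)
  fix l assume "l \<in> ?L"
  then have lo: "linear_order_on A l" and rl: "Restr r A \<subseteq> l"
    by (auto simp: linear_extensions_def)
  obtain x where x: "x \<in> A" "\<forall>y\<in>A. (y, x) \<in> l"
    using linear_order_on_has_greatest[OF assms subset_refl lo] by blast
  have l: "l \<subseteq> A \<times> A" "refl_on A l" "trans l" "antisym l" "total_on A l"
    using lo by (auto simp: order_on_defs)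
  have "\<forall>y\<in>A. (x, y) \<in> r \<longrightarrow> y = x"
    using x rl l(4) by (auto dest: antisymD)
  moreover have "linear_order_on (A - {x}) (Restr l (A - {x}))"
    unfolding order_on_defs
  proof (intro conjI)
    show "trans (Restr l (A - {x}))"
      using l(3) by (rule trans_Restr)
    show "antisym (Restr l (A - {x}))"
      using l(4) by (rule antisym_subset[rotated]) blast
  qed (use l(2,5) in \<open>auto simp: refl_on_def total_on_def\<close>)
  then have "Restr l (A - {x}) \<in> linear_extensions (A - {x}) (Restr r (A - {x}))"
    using rl by (auto simp: linear_extensions_def)
  moreover have "l = Restr l (A - {x}) \<union> A \<times> {x}"
    using l(1,4) x by (auto dest: antisymD)
  ultimately show "l \<in> ?R" using x(1) by blast
next
  fix l assume "l \<in> ?R"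
  then obtain x l' where x: "x \<in> A" "\<forall>y\<in>A. (x, y) \<in> r \<longrightarrow> y = x" "l = l' \<union> A \<times> {x}"
    and l': "linear_order_on (A - {x}) l'" "Restr r (A - {x}) \<subseteq> l'"
    by (auto simp: linear_extensions_def)
  have l'_props: "l' \<subseteq> (A - {x}) \<times> (A - {x})" "refl_on (A - {x}) l'" "trans l'" "antisym l'" "total_on (A - {x}) l'"
    using l' by (auto simp: order_on_defs)
  have "linear_order_on A l"
    unfolding x(3) order_on_defs
  proof (intro conjI)
    show "trans (l' \<union> A \<times> {x})"
      using l'_props(1,3) x(1) by (auto intro!: transI dest: transD)
    show "antisym (l' \<union> A \<times> {x})"
      using l'_props(1,4) by (auto intro!: antisymI dest: antisymD)
  qed (use l'_props x(1) in \<open>auto simp: refl_on_def total_on_def\<close>)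
  moreover have "Restr r A \<subseteq> l"
    using x l'(2) by auto
  ultimately show "l \<in> ?L" by (simp add: linear_extensions_def)
qed

lemma num_linear_extensions_remove_greatest:
  assumes "finite A" "A \<noteq> {}"
  shows "num_linear_extensions A (Restr r A) =
    (\<Sum>x\<in>{x\<in>A. \<forall>y\<in>A. (x, y) \<in> r \<longrightarrow> y = x}.
       num_linear_extensions (A - {x}) (Restr r (A - {x})))"
proof -
  let ?M = "{x\<in>A. \<forall>y\<in>A. (x, y) \<in> r \<longrightarrow> y = x}"
  let ?S = "\<lambda>x. linear_extensions (A - {x}) (Restr r (A - {x}))"
  let ?T = "\<lambda>x. (\<lambda>l. l \<union> A \<times> {x}) ` ?S x"
  have sub: "l \<subseteq> (A - {x}) \<times> (A - {x})" if "l \<in> ?S x" for l x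
    using that by (auto simp: linear_extensions_def order_on_defs)
  have "num_linear_extensions A (Restr r A) = card (\<Union>x\<in>?M. ?T x)"
    unfolding num_linear_extensions_def
    by (subst linear_extensions_remove_greatest[OF assms]) (rule refl)
  also have "\<dots> = (\<Sum>x\<in>?M. card (?T x))"
  proof (rule card_UN_disjoint)
    show "\<forall>x\<in>?M. finite (?T x)"
      using assms(1) by (auto intro: finite_linear_extensions)
    have "?T x \<inter> ?T y = {}" if "x \<in> ?M" "y \<in> ?M" "x \<noteq> y" for x y
    proof (rule ccontr)
      assume "?T x \<inter> ?T y \<noteq> {}"
      then obtain k l where kl: "k \<in> ?S x" "l \<in> ?S y" "k \<union> A \<times> {x} = l \<union> A \<times> {y}"
        by auto
      \<comment> \<open>A common extension would have two greatest elements: the pair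
        \<open>(y, x)\<close> cannot come from \<open>A \<times> {y}\<close>, and \<open>l\<close>
        does not contain \<open>y\<close> at all.\<close>
      have "(y, x) \<in> k \<union> A \<times> {x}" using that by auto
      then have "(y, x) \<in> l" using kl that by auto
      then show False using sub[OF kl(2)] by auto
    qed
    then show "\<forall>x\<in>?M. \<forall>y\<in>?M. x \<noteq> y \<longrightarrow> ?T x \<inter> ?T y = {}" by blast
  qed (use assms in simp)
  also have "\<dots> = (\<Sum>x\<in>?M. card (?S x))"
  proof (rule sum.cong[OF refl], rule card_image, rule inj_onI)
    fix x k l assume kl: "k \<in> ?S x" "l \<in> ?S x" "k \<union> A \<times> {x} = l \<union> A \<times> {x}"
    then show "k = l" using sub[OF kl(1)] sub[OF kl(2)] by blast
  qed
  finally show ?thesis by (simp add: num_linear_extensions_def)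
qed

lemma num_linear_extensions_empty: "num_linear_extensions {} {} = 1"
proof -
  have "linear_extensions {} {} = {{} :: 'a rel}"
    by (auto simp: linear_extensions_def order_on_defs refl_on_def)
  then show ?thesis by (simp add: num_linear_extensions_def)
qed

section \<open>Factorial estimates from chain partitions and level partitions\<close>

lemma prod_fact_fibres_remove:
  fixes g :: "'a \<Rightarrow> 'b"
  assumes "finite A" "finite I" "x \<in> A" "g x \<in> I"
  shows "(\<Prod>i\<in>I. fact (card {y\<in>A. g y = i})) =
    card {y\<in>A. g y = g x} * (\<Prod>i\<in>I. fact (card {y\<in>A - {x}. g y = i}) :: nat)"
proof -
  \<comment> \<open>Only the fibre through \<open>x\<close> changes; it loses one point, so its
    factorial loses the factor equal to its old size.\<close>
  have "{y\<in>A - {x}. g y = g x} = {y\<in>A. g y = g x} - {x}" by auto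
  then have "fact (card {y\<in>A. g y = g x}) =
      card {y\<in>A. g y = g x} * (fact (card {y\<in>A - {x}. g y = g x}) :: nat)"
    using assms by (subst fact_reduce) (auto simp: card_gt_0_iff)
  moreover have "{y\<in>A - {x}. g y = i} = {y\<in>A. g y = i}" if "i \<in> I - {g x}" for i
    using that by auto
  ultimately show ?thesis
    using assms by (simp add: prod.remove[of I "g x"])
qed

text \<open>Strip the greatest element \<open>x\<close>: the induction hypothesis bounds its summand
  by \<open>fact (card A - 1)\<close> times the size of the chain through \<open>x\<close>. Distinct
  maximal elements lie in distinct chains, so these sizes add up to at most
  \<open>card A\<close>.\<close>

theorem num_linear_extensions_chain_partition:
  fixes g :: "'a \<Rightarrow> 'b"
  assumes "finite A" "finite I" "g ` A \<subseteq> I"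
    and chain: "\<And>x y. x \<in> A \<Longrightarrow> y \<in> A \<Longrightarrow> g x = g y \<Longrightarrow> (x, y) \<in> r \<or> (y, x) \<in> r"
  shows "num_linear_extensions A (Restr r A) * (\<Prod>i\<in>I. fact (card {x\<in>A. g x = i})) \<le> fact (card A)"
  using assms(1,3) chain
proof (induction A rule: finite_psubset_induct)
  case (psubset A)
  show ?case
  proof (cases "A = {}")
    case True
    then show ?thesis by (simp add: num_linear_extensions_empty)
  next
    case False
    let ?M = "{x\<in>A. \<forall>y\<in>A. (x, y) \<in> r \<longrightarrow> y = x}"
    let ?N = "\<lambda>A. num_linear_extensions A (Restr r A)"
    let ?P = "\<lambda>A. (\<Prod>i\<in>I. fact (card {x\<in>A. g x = i})) :: nat"
    have "?N A * ?P A = (\<Sum>x\<in>?M. ?N (A - {x}) * ?P A)"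
      by (subst num_linear_extensions_remove_greatest[OF psubset.hyps(1) False])
        (simp add: sum_distrib_right)
    also have "\<dots> \<le> (\<Sum>x\<in>?M. fact (card A - 1) * card {y\<in>A. g y = g x})"
    proof (rule sum_mono)
      fix x assume x: "x \<in> ?M"
      have "?N (A - {x}) * ?P (A - {x}) \<le> fact (card (A - {x}))"
        using x psubset.prems by (intro psubset.IH) auto
      moreover have "?P A = card {y\<in>A. g y = g x} * ?P (A - {x})"
        using x psubset.hyps psubset.prems assms(2) by (intro prod_fact_fibres_remove) auto
      ultimately show "?N (A - {x}) * ?P A \<le> fact (card A - 1) * card {y\<in>A. g y = g x}"
        using x psubset.hyps by (simp add: mult.left_commute mult.commute)
    qed
    also have "\<dots> = fact (card A - 1) * card (\<Union>x\<in>?M. {y\<in>A. g y = g x})"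
    proof (subst card_UN_disjoint)
      \<comment> \<open>Two maximal elements in one fibre would be comparable, hence equal.\<close>
      have "g x \<noteq> g y" if "x \<in> ?M" "y \<in> ?M" "x \<noteq> y" for x y
        using that psubset.prems(2)[of x y] by auto
      then show "\<forall>x\<in>?M. \<forall>y\<in>?M. x \<noteq> y \<longrightarrow> {z\<in>A. g z = g x} \<inter> {z\<in>A. g z = g y} = {}"
        by auto
    qed (use psubset.hyps in \<open>simp_all add: sum_distrib_left\<close>)
    also have "\<dots> \<le> fact (card A - 1) * card A"
      using psubset.hyps by (intro mult_le_mono2 card_mono) auto
    also have "\<dots> = fact (card A)"
      using False psubset.hyps by (subst fact_reduce[of "card A"]) (auto simp: card_gt_0_iff)
    finally show ?thesis .
  qed
qed

text \<open>Dual to the chain estimate: keep only the summands for the top level \<open>F\<close>,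
  all of whose points are maximal. Removing any one of them divides the product by
  \<open>card F\<close>, and there are \<open>card F\<close> of them.\<close>

theorem num_linear_extensions_antichain_partition:
  fixes h :: "'a \<Rightarrow> nat"
  assumes "finite A" "finite I" "h ` A \<subseteq> I"
    and mono: "\<And>x y. x \<in> A \<Longrightarrow> y \<in> A \<Longrightarrow> (x, y) \<in> r \<Longrightarrow> x \<noteq> y \<Longrightarrow> h x < h y"
  shows "(\<Prod>i\<in>I. fact (card {x\<in>A. h x = i})) \<le> num_linear_extensions A (Restr r A)"
  using assms(1,3) mono
proof (induction A rule: finite_psubset_induct)
  case (psubset A)
  show ?case
  proof (cases "A = {}")
    case True
    then show ?thesis by (simp add: num_linear_extensions_empty)
  next
    case False
    let ?M = "{x\<in>A. \<forall>y\<in>A. (x, y) \<in> r \<longrightarrow> y = x}"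
    let ?N = "\<lambda>A. num_linear_extensions A (Restr r A)"
    let ?P = "\<lambda>A. (\<Prod>i\<in>I. fact (card {x\<in>A. h x = i})) :: nat"
    define F where "F = {x\<in>A. h x = Max (h ` A)}"
    have top: "h x \<le> Max (h ` A)" if "x \<in> A" for x
      using that psubset.hyps by simp
    have "Max (h ` A) \<in> h ` A" using False psubset.hyps by simp
    then have "F \<noteq> {}" by (force simp: F_def)
    then have F0: "card F > 0" using psubset.hyps by (simp add: F_def card_gt_0_iff)
    have FM: "F \<subseteq> ?M"
      using psubset.prems(2) top by (auto simp: F_def) (metis leD)
    \<comment> \<open>Both sides are multiplied by \<open>card F\<close>, so that no division of
      natural numbers is needed; the factor is cancelled at the end.\<close>
    have "card F * ?P A = (\<Sum>x\<in>F. ?P A)" by simp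
    also have "\<dots> \<le> (\<Sum>x\<in>F. card F * ?N (A - {x}))"
    proof (rule sum_mono)
      fix x assume x: "x \<in> F"
      then have "?P (A - {x}) \<le> ?N (A - {x})"
        using psubset.prems by (intro psubset.IH) (auto simp: F_def)
      moreover have "?P A = card {y\<in>A. h y = h x} * ?P (A - {x})"
        using x psubset.hyps psubset.prems assms(2) by (intro prod_fact_fibres_remove) (auto simp: F_def)
      moreover have "{y\<in>A. h y = h x} = F" using x by (auto simp: F_def)
      ultimately show "?P A \<le> card F * ?N (A - {x})" by simp
    qed
    also have "\<dots> = card F * (\<Sum>x\<in>F. ?N (A - {x}))" by (simp add: sum_distrib_left)
    also have "\<dots> \<le> card F * (\<Sum>x\<in>?M. ?N (A - {x}))"
      using FM psubset.hyps by (intro mult_le_mono2 sum_mono2) auto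
    also have "\<dots> = card F * ?N A"
      by (subst num_linear_extensions_remove_greatest[OF psubset.hyps(1) False]) simp
    finally show ?thesis using F0 by simp
  qed
qed

subsection \<open>Mirsky's and Dilworth's theorems\<close>

lemma finite_poset_has_maximal:
  assumes "finite A" "A \<noteq> {}" "trans r" "antisym r"
  shows "\<exists>a\<in>A. \<forall>y\<in>A. (a, y) \<in> r \<longrightarrow> y = a"
  using assms(1,2)
proof (induction A rule: finite_ne_induct)
  case (insert z A)
  then obtain a where a: "a \<in> A" "\<forall>y\<in>A. (a, y) \<in> r \<longrightarrow> y = a" by blast
  show ?case
  proof (cases "(a, z) \<in> r")
    case True
    have "y = z" if "y \<in> A" "(z, y) \<in> r" for y
    proof -
      have "(a, y) \<in> r" using True that assms(3) by (blast dest: transD)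
      then have "y = a" using a that by blast
      then show ?thesis using True that assms(4) by (blast dest: antisymD)
    qed
    then show ?thesis by auto
  qed (use a in auto)
qed auto

text \<open>\<open>h x\<close> is one less than the size of a longest chain with greatest element \<open>x\<close>.\<close>

lemma height_function:
  assumes "finite A" "trans r" "antisym r" "\<forall>x\<in>A. (x, x) \<in> r"
  shows "\<exists>h :: 'a \<Rightarrow> nat. (\<forall>x\<in>A. \<forall>y\<in>A. (x, y) \<in> r \<longrightarrow> x \<noteq> y \<longrightarrow> h x < h y) \<and>
    (\<forall>a\<in>A. \<exists>C\<subseteq>A. card C = Suc (h a) \<and> (\<forall>x\<in>C. (x, a) \<in> r) \<and>
       (\<forall>x\<in>C. \<forall>y\<in>C. (x, y) \<in> r \<or> (y, x) \<in> r))"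
  using assms(1,4)
proof (induction A rule: finite_psubset_induct)
  case (psubset A)
  show ?case
  proof (cases "A = {}")
    case True
    then show ?thesis by simp
  next
    case False
    then obtain a where a: "a \<in> A" "\<forall>y\<in>A. (a, y) \<in> r \<longrightarrow> y = a"
      using finite_poset_has_maximal[OF psubset.hyps(1) _ assms(2,3)] by blast
    obtain h :: "'a \<Rightarrow> nat" where
      h: "\<And>x y. x \<in> A - {a} \<Longrightarrow> y \<in> A - {a} \<Longrightarrow> (x, y) \<in> r \<Longrightarrow> x \<noteq> y \<Longrightarrow> h x < h y"
      and C: "\<And>b. b \<in> A - {a} \<Longrightarrow> \<exists>C\<subseteq>A - {a}. card C = Suc (h b) \<and> (\<forall>x\<in>C. (x, b) \<in> r) \<and>
         (\<forall>x\<in>C. \<forall>y\<in>C. (x, y) \<in> r \<or> (y, x) \<in> r)"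
    proof -
      have "\<exists>h :: 'a \<Rightarrow> nat. (\<forall>x\<in>A - {a}. \<forall>y\<in>A - {a}. (x, y) \<in> r \<longrightarrow> x \<noteq> y \<longrightarrow> h x < h y) \<and>
        (\<forall>b\<in>A - {a}. \<exists>C\<subseteq>A - {a}. card C = Suc (h b) \<and> (\<forall>x\<in>C. (x, b) \<in> r) \<and>
           (\<forall>x\<in>C. \<forall>y\<in>C. (x, y) \<in> r \<or> (y, x) \<in> r))"
        using a(1) psubset.prems by (intro psubset.IH) auto
      then show ?thesis by (elim exE conjE) (rule that; blast)
    qed
    define B where "B = {x\<in>A - {a}. (x, a) \<in> r}"
    \<comment> \<open>Since \<open>a\<close> is maximal, it is strictly below nothing, so old values
      need not change: \<open>a\<close> only has to exceed every height below it.\<close>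
    define h' where "h' = h(a := if B = {} then 0 else Suc (Max (h ` B)))"
    have finB: "finite B" using psubset.hyps by (simp add: B_def)
    have mono: "h' x < h' y" if "x \<in> A" "y \<in> A" "(x, y) \<in> r" "x \<noteq> y" for x y
    proof (cases "y = a")
      case True
      then have "x \<in> B" using that by (auto simp: B_def)
      then have "h x \<le> Max (h ` B)" using finB by simp
      then show ?thesis using True that \<open>x \<in> B\<close> by (auto simp: h'_def)
    next
      case False
      then have "x \<noteq> a" using a that by blast
      then show ?thesis using h[of x y] that False by (simp add: h'_def)
    qed
    have "\<exists>C\<subseteq>A. card C = Suc (h' b) \<and> (\<forall>x\<in>C. (x, b) \<in> r) \<and>
       (\<forall>x\<in>C. \<forall>y\<in>C. (x, y) \<in> r \<or> (y, x) \<in> r)" if b: "b \<in> A" for b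
    proof (cases "b = a")
      case False
      then show ?thesis using C[of b] b by (auto simp: h'_def; blast)
    next
      case True
      show ?thesis
      proof (cases "B = {}")
        case True
        then show ?thesis using \<open>b = a\<close> a psubset.prems
          by (intro exI[of _ "{a}"]) (auto simp: h'_def)
      next
        case False
        then obtain c where c: "c \<in> B" "h c = Max (h ` B)"
          using finB Max_in[of "h ` B"] by (metis (no_types) finite_imageI image_iff image_is_empty)
        then obtain D where D: "D \<subseteq> A - {a}" "card D = Suc (h c)" "\<forall>x\<in>D. (x, c) \<in> r"
          "\<forall>x\<in>D. \<forall>y\<in>D. (x, y) \<in> r \<or> (y, x) \<in> r"
          using C[of c] by (auto simp: B_def)
        \<comment> \<open>The chain \<open>D\<close> for \<open>c\<close>, a highest point strictly
          below \<open>a\<close>, lies wholly below \<open>a\<close> and can be extended by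
          it.\<close>
        have "\<forall>x\<in>D. (x, a) \<in> r"
          using D(3) c(1) assms(2) by (auto simp: B_def dest: transD)
        moreover have "finite D" "a \<notin> D" using D(1) psubset.hyps finite_subset by auto
        ultimately show ?thesis
          using \<open>b = a\<close> False c D a(1) psubset.prems
          by (intro exI[of _ "insert a D"]) (auto simp: h'_def)
      qed
    qed
    with mono show ?thesis by blast
  qed
qed

text \<open>Take a point of maximal height \<open>H\<close>: it tops a chain of \<open>H + 1\<close>
  elements, while all heights lie in \<open>0..H\<close>.\<close>

theorem mirsky:
  assumes "finite A" "trans r" "antisym r" "\<forall>x\<in>A. (x, x) \<in> r"
  obtains C and h :: "'a \<Rightarrow> nat" where "C \<subseteq> A"
    "\<And>x y. x \<in> C \<Longrightarrow> y \<in> C \<Longrightarrow> (x, y) \<in> r \<or> (y, x) \<in> r"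
    "h ` A \<subseteq> {..<card C}"
    "\<And>x y. x \<in> A \<Longrightarrow> y \<in> A \<Longrightarrow> (x, y) \<in> r \<Longrightarrow> x \<noteq> y \<Longrightarrow> h x < h y"
proof (cases "A = {}")
  case True
  then show ?thesis using that[of "{}"] by auto
next
  case False
  obtain h :: "'a \<Rightarrow> nat" where
    h: "\<forall>x\<in>A. \<forall>y\<in>A. (x, y) \<in> r \<longrightarrow> x \<noteq> y \<longrightarrow> h x < h y"
    and C: "\<forall>a\<in>A. \<exists>C\<subseteq>A. card C = Suc (h a) \<and> (\<forall>x\<in>C. (x, a) \<in> r) \<and>
       (\<forall>x\<in>C. \<forall>y\<in>C. (x, y) \<in> r \<or> (y, x) \<in> r)"
    using height_function[OF assms] by (elim exE conjE)
  obtain a where a: "a \<in> A" "h a = Max (h ` A)"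
    using Max_in[of "h ` A"] False assms(1) by (metis (no_types) finite_imageI image_iff image_is_empty)
  obtain D where D: "D \<subseteq> A" "card D = Suc (h a)" "\<forall>x\<in>D. \<forall>y\<in>D. (x, y) \<in> r \<or> (y, x) \<in> r"
    using bspec[OF C a(1)] by blast
  have "h ` A \<subseteq> {..<card D}"
    using a(2) D(2) assms(1) by (auto simp: less_Suc_eq_le)
  then show ?thesis
    using h D(3) by (intro that[OF D(1), of h]) auto
qed

text \<open>Galvin's proof: remove a maximal element, and compare with the antichain formed by the
  highest element of each chain that lies in some antichain of maximum size.\<close>

theorem dilworth:
  assumes "finite A" "trans r" "antisym r" "\<forall>x\<in>A. (x, x) \<in> r"
  shows "\<exists>W (g :: 'a \<Rightarrow> nat). W \<subseteq> A \<and> (\<forall>x\<in>W. \<forall>y\<in>W. (x, y) \<in> r \<longrightarrow> x = y) \<and>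
    g ` A \<subseteq> {..<card W} \<and> (\<forall>x\<in>A. \<forall>y\<in>A. g x = g y \<longrightarrow> (x, y) \<in> r \<or> (y, x) \<in> r)"
  using assms(1,4)
proof (induction A rule: finite_psubset_induct)
  case (psubset A)
  show ?case
  proof (cases "A = {}")
    case True
    then show ?thesis by auto
  next
    case False
    define anti where "anti V \<longleftrightarrow> (\<forall>x\<in>V. \<forall>y\<in>V. (x, y) \<in> r \<longrightarrow> x = y)" for V
    obtain a where a: "a \<in> A" "\<forall>y\<in>A. (a, y) \<in> r \<longrightarrow> y = a"
      using finite_poset_has_maximal[OF psubset.hyps(1) False assms(2,3)] by blast
    define A' where "A' = A - {a}"
    have finA': "finite A'" using psubset.hyps by (simp add: A'_def)
    obtain W and g :: "'a \<Rightarrow> nat" where W: "W \<subseteq> A'" "anti W" and g: "g ` A' \<subseteq> {..<card W}"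
      and chain: "\<And>x y. x \<in> A' \<Longrightarrow> y \<in> A' \<Longrightarrow> g x = g y \<Longrightarrow> (x, y) \<in> r \<or> (y, x) \<in> r"
    proof -
      have "\<exists>W (g :: 'a \<Rightarrow> nat). W \<subseteq> A' \<and> (\<forall>x\<in>W. \<forall>y\<in>W. (x, y) \<in> r \<longrightarrow> x = y) \<and>
        g ` A' \<subseteq> {..<card W} \<and> (\<forall>x\<in>A'. \<forall>y\<in>A'. g x = g y \<longrightarrow> (x, y) \<in> r \<or> (y, x) \<in> r)"
        using a(1) psubset.prems by (intro psubset.IH) (auto simp: A'_def)
      then show ?thesis by (elim exE conjE) (rule that; auto simp: anti_def)
    qed
    \<comment> \<open>An antichain meets each chain at most once. So \<open>W\<close> is a maximum
      antichain of \<open>A'\<close>, and every antichain of the same size meets all the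
      chains.\<close>
    have inj: "inj_on g V" if "V \<subseteq> A'" "anti V" for V
      using that chain unfolding inj_on_def anti_def by (metis subsetD)
    have card_le: "card V \<le> card W" if "V \<subseteq> A'" "anti V" for V
      using card_inj_on_le[OF inj[OF that], of "{..<card W}"] that g by auto
    have meets: "\<exists>x\<in>V. g x = i" if "V \<subseteq> A'" "anti V" "card V = card W" "i < card W" for V i
    proof -
      have "g ` V = {..<card W}"
        using that g by (intro card_subset_eq) (auto simp: card_image[OF inj])
      then show ?thesis using that(4) by (metis imageE lessThan_iff)
    qed
    \<comment> \<open>\<open>S i\<close> collects the points of chain \<open>i\<close> that lie on
      maximum antichains; \<open>t i\<close> will be its highest point.\<close>
    define S where "S i = {x\<in>A'. g x = i \<and> (\<exists>V\<subseteq>A'. anti V \<and> card V = card W \<and> x \<in> V)}" for i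
    have "\<exists>x\<in>S i. \<forall>y\<in>S i. (y, x) \<in> r" if "i < card W" for i
    proof -
      have "S i \<noteq> {}" using meets[OF W refl that] W by (auto simp: S_def)
      moreover have "finite (S i)" using finA' by (simp add: S_def)
      ultimately obtain x where x: "x \<in> S i" "\<forall>y\<in>S i. (x, y) \<in> r \<longrightarrow> y = x"
        using finite_poset_has_maximal[OF _ _ assms(2,3)] by blast
      have "(y, x) \<in> r" if "y \<in> S i" for y
        using chain[of x y] x that by (auto simp: S_def)
      with x show ?thesis by blast
    qed
    then obtain t where t: "\<And>i. i < card W \<Longrightarrow> t i \<in> S i"
      and tmax: "\<And>i y. i < card W \<Longrightarrow> y \<in> S i \<Longrightarrow> (y, t i) \<in> r"
      by metis
    have gt: "g (t i) = i" "t i \<in> A'" if "i < card W" for i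
      using t[OF that] by (auto simp: S_def)
    \<comment> \<open>If \<open>t i\<close> is below \<open>t j\<close>, a maximum antichain through
      \<open>t j\<close> meets chain \<open>i\<close> in some \<open>y\<close> below
      \<open>t i\<close>, hence below \<open>t j\<close>; so \<open>y = t j\<close> and the chains
      agree.\<close>
    have t_anti: "i = j" if ij: "i < card W" "j < card W" "(t i, t j) \<in> r" for i j
    proof -
      obtain V where V: "V \<subseteq> A'" "anti V" "card V = card W" "t j \<in> V"
        using t[OF ij(2)] by (auto simp: S_def)
      obtain y where y: "y \<in> V" "g y = i" using meets[OF V(1-3) ij(1)] by blast
      then have "y \<in> S i" using V by (auto simp: S_def)
      then have "(y, t j) \<in> r" using tmax[OF ij(1)] ij(3) assms(2) by (blast dest: transD)
      then have "y = t j" using V y by (auto simp: anti_def)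
      then show ?thesis using y gt ij by auto
    qed
    show ?thesis
    proof (cases "\<exists>i<card W. (t i, a) \<in> r")
      case False
      \<comment> \<open>The point \<open>a\<close> is incomparable to every \<open>t i\<close>, so
        the width grows by one and \<open>a\<close> can form a chain of its own, with the fresh
        colour \<open>card W\<close>.\<close>
      define X where "X = insert a (t ` {..<card W})"
      have "inj_on t {..<card W}" using gt by (metis inj_onI lessThan_iff)
      moreover have "a \<notin> t ` {..<card W}" using gt by (auto simp: A'_def)
      ultimately have cardX: "card X = Suc (card W)" by (simp add: X_def card_image)
      have "X \<subseteq> A" using gt a by (auto simp: X_def A'_def)
      moreover have "\<forall>x\<in>X. \<forall>y\<in>X. (x, y) \<in> r \<longrightarrow> x = y"
        using False a(2) gt t_anti unfolding X_def A'_def by blast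
      moreover have "(g(a := card W)) ` A \<subseteq> {..<card X}"
        using g cardX by (force simp: A'_def)
      moreover have "(x, y) \<in> r \<or> (y, x) \<in> r"
        if xy: "x \<in> A" "y \<in> A" "(g(a := card W)) x = (g(a := card W)) y" for x y
      proof (cases "x = a \<or> y = a")
        case True
        have "g z \<noteq> card W" if "z \<in> A'" for z using g that by auto
        then have "x = a \<and> y = a" using True xy by (auto simp: A'_def split: if_splits)
        then show ?thesis using psubset.prems a by auto
      next
        case False
        then show ?thesis using chain[of x y] xy by (auto simp: A'_def)
      qed
      ultimately show ?thesis by (intro exI[of _ X] exI[of _ "g(a := card W)"]) blast
    next
      case True
      then obtain i where i: "i < card W" "(t i, a) \<in> r" by blast
      \<comment> \<open>\<open>K\<close> is a chain, because its points other than \<open>a\<close>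
        lie on chain \<open>i\<close> and below \<open>t i\<close>, which is below \<open>a\<close>.
        The aim is that removing \<open>K\<close> lowers the width.\<close>
      define K where "K = insert a {z\<in>A'. g z = i \<and> (z, t i) \<in> r}"
      have "A - K \<subset> A" using a by (auto simp: K_def)
      obtain W' and g' :: "'a \<Rightarrow> nat" where W': "W' \<subseteq> A - K" "anti W'"
        and g': "g' ` (A - K) \<subseteq> {..<card W'}"
        and chain': "\<And>x y. x \<in> A - K \<Longrightarrow> y \<in> A - K \<Longrightarrow> g' x = g' y \<Longrightarrow> (x, y) \<in> r \<or> (y, x) \<in> r"
      proof -
        have "\<exists>W (g :: 'a \<Rightarrow> nat). W \<subseteq> A - K \<and> (\<forall>x\<in>W. \<forall>y\<in>W. (x, y) \<in> r \<longrightarrow> x = y) \<and>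
          g ` (A - K) \<subseteq> {..<card W} \<and>
          (\<forall>x\<in>A - K. \<forall>y\<in>A - K. g x = g y \<longrightarrow> (x, y) \<in> r \<or> (y, x) \<in> r)"
          using \<open>A - K \<subset> A\<close> psubset.prems by (intro psubset.IH) auto
        then show ?thesis by (elim exE conjE) (rule that; auto simp: anti_def)
      qed
      have W'A: "W' \<subseteq> A'" using W' by (auto simp: A'_def K_def)
      \<comment> \<open>An antichain of size \<open>card W\<close> avoiding \<open>K\<close> would
        contain a point of \<open>S i\<close>; this is below \<open>t i\<close>, hence in
        \<open>K\<close>.\<close>
      have "card W' \<noteq> card W"
      proof
        assume eq: "card W' = card W"
        obtain z where z: "z \<in> W'" "g z = i" using meets[OF W'A W'(2) eq i(1)] by blast
        then have "z \<in> S i" using W'A W' eq by (auto simp: S_def)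
        then have "z \<in> K" using tmax[OF i(1)] z W'A by (auto simp: K_def)
        then show False using z W' by blast
      qed
      then have lt: "card W' < card W" using card_le[OF W'A W'(2)] by simp
      define c where "c x = (if x \<in> K then card W' else g' x)" for x
      have Kchain: "(x, y) \<in> r \<or> (y, x) \<in> r" if "x \<in> K" "y \<in> K" for x y
      proof -
        have "(z, a) \<in> r" if "z \<in> K" for z
          using that i(2) assms(2) psubset.prems a(1) by (auto simp: K_def dest: transD)
        then show ?thesis using that chain[of x y] by (auto simp: K_def)
      qed
      have "(x, y) \<in> r \<or> (y, x) \<in> r" if xy: "x \<in> A" "y \<in> A" "c x = c y" for x y
      proof -
        have "g' z \<noteq> card W'" if "z \<in> A - K" for z using g' that by auto
        then have "x \<in> K \<longleftrightarrow> y \<in> K" using xy by (auto simp: c_def split: if_splits)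
        then show ?thesis using xy Kchain chain' by (auto simp: c_def split: if_splits)
      qed
      moreover have "c ` A \<subseteq> {..<card W}"
        using g' lt by (fastforce simp: c_def)
      moreover have "W \<subseteq> A" using W by (auto simp: A'_def)
      ultimately show ?thesis
        using W(2) unfolding anti_def by (intro exI[of _ W] exI[of _ c]) blast
    qed
  qed
qed

subsection \<open>Chains, antichains and comparable pairs\<close>

lemma comparability_edges_subset:
  assumes "r \<subseteq> A \<times> A"
  shows "comparability_edges r \<subseteq> {e. e \<subseteq> A \<and> card e = 2}"
  using assms by (auto simp: comparability_edges_def)

lemma chain_choose_two_le_num_comparable_pairs:
  assumes "finite A" "r \<subseteq> A \<times> A" "C \<subseteq> A"
    and "\<And>x y. x \<in> C \<Longrightarrow> y \<in> C \<Longrightarrow> (x, y) \<in> r \<or> (y, x) \<in> r"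
  shows "card C choose 2 \<le> num_comparable_pairs r"
proof -
  have "{e. e \<subseteq> C \<and> card e = 2} \<subseteq> comparability_edges r"
  proof
    fix e assume "e \<in> {e. e \<subseteq> C \<and> card e = 2}"
    then obtain x y where e: "e = {x, y}" "x \<noteq> y" "x \<in> C" "y \<in> C" by (auto simp: card_2_iff)
    then consider "(x, y) \<in> r" | "(y, x) \<in> r" using assms(4) by blast
    then show "e \<in> comparability_edges r"
    proof cases
      case 2
      then show ?thesis using e insert_commute[of x y] by (fastforce simp: comparability_edges_def)
    qed (use e in \<open>auto simp: comparability_edges_def\<close>)
  qed
  moreover have "finite (comparability_edges r)"
    using comparability_edges_subset[OF assms(2)] by (rule finite_subset) (use assms(1) in simp)
  ultimately have "card {e. e \<subseteq> C \<and> card e = 2} \<le> num_comparable_pairs r"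
    unfolding num_comparable_pairs_def by (intro card_mono)
  then show ?thesis
    using assms(1,3) by (simp add: n_subsets finite_subset)
qed

text \<open>The pairs inside \<open>W\<close> and the comparable pairs are disjoint families of
  two-element subsets of \<open>A\<close>.\<close>

lemma antichain_choose_two_le_incomparable_pairs:
  assumes "finite A" "r \<subseteq> A \<times> A" "W \<subseteq> A"
    and "\<And>x y. x \<in> W \<Longrightarrow> y \<in> W \<Longrightarrow> (x, y) \<in> r \<Longrightarrow> x = y"
  shows "(card W choose 2) + num_comparable_pairs r \<le> card A choose 2"
proof -
  let ?E = "\<lambda>A. {e. e \<subseteq> A \<and> card e = 2}"
  have fin: "finite (?E A)" "finite W" using assms finite_subset by auto
  have sub: "?E W \<subseteq> ?E A" "comparability_edges r \<subseteq> ?E A"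
    using assms(3) comparability_edges_subset[OF assms(2)] by auto
  have disj: "?E W \<inter> comparability_edges r = {}"
    using assms(4) by (auto simp: comparability_edges_def)
  have "(card W choose 2) + num_comparable_pairs r = card (?E W \<union> comparability_edges r)"
    unfolding num_comparable_pairs_def
    by (subst card_Un_disjoint) (use fin sub disj in \<open>auto simp: n_subsets intro: finite_subset\<close>)
  also have "\<dots> \<le> card (?E A)" using fin sub by (intro card_mono) auto
  finally show ?thesis using assms(1) by (simp add: n_subsets)
qed

subsection \<open>Partitions into few parts\<close>

text \<open>At most \<open>m\<close> of the factors of \<open>fact a\<close> are smaller than
  \<open>Suc m\<close>, so \<open>fact a\<close> is at least \<open>Suc m\<close> to the power
  \<open>a - m\<close>. The multiplied-out form also covers \<open>a < m\<close>.\<close>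

lemma Suc_power_le_fact: "Suc m ^ a \<le> fact a * Suc m ^ m"
proof (induction a)
  case (Suc a)
  show ?case
  proof (cases "a < m")
    case True
    then have "Suc m ^ Suc a \<le> 1 * Suc m ^ m" by (simp only: mult_1) (intro power_increasing, auto)
    also have "\<dots> \<le> fact (Suc a) * Suc m ^ m" by (intro mult_le_mono1 fact_ge_1)
    finally show ?thesis .
  next
    case False
    then have "Suc m * Suc m ^ a \<le> Suc a * (fact a * Suc m ^ m)"
      using Suc by (intro mult_le_mono) auto
    then show ?thesis by (simp add: algebra_simps)
  qed
qed simp

text \<open>For \<open>n\<close> points in \<open>w\<close> parts, the product of factorials is at
  least \<open>Suc m\<close> to the power \<open>n - m * w\<close>, which is exponential in
  \<open>n\<close> when \<open>w\<close> is well below \<open>n / m\<close>.\<close>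

lemma Suc_power_le_prod_fact:
  assumes "finite I"
  shows "Suc m ^ (\<Sum>i\<in>I. a i) \<le> (\<Prod>i\<in>I. fact (a i)) * Suc m ^ (m * card I)"
proof -
  have "Suc m ^ (\<Sum>i\<in>I. a i) = (\<Prod>i\<in>I. Suc m ^ a i)" by (simp add: power_sum)
  also have "\<dots> \<le> (\<Prod>i\<in>I. fact (a i) * Suc m ^ m)"
    by (intro prod_mono conjI Suc_power_le_fact) simp
  also have "\<dots> = (\<Prod>i\<in>I. fact (a i)) * Suc m ^ (m * card I)"
    by (simp add: prod.distrib power_mult)
  finally show ?thesis .
qed

lemma sum_card_fibres:
  assumes "finite A" "finite I" "g ` A \<subseteq> I"
  shows "(\<Sum>i\<in>I. card {x\<in>A. g x = i}) = card A"
  using sum.group[OF assms(1,2,3), of "\<lambda>_. 1::nat"] by simp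

lemma real_choose_two: "real (k choose 2) = real k * (real k - 1) / 2"
  by (cases k) (simp_all add: choose_two real_of_nat_div algebra_simps)

lemma le_sqrt_of_choose_two_le:
  fixes \<epsilon> :: real
  assumes "real (w choose 2) \<le> \<epsilon> * real (n choose 2)" "0 \<le> \<epsilon>"
  shows "real w \<le> sqrt \<epsilon> * real n + 1"
\<comment> \<open>The first inequality below, between \<open>(w - 1)^2\<close> and
  \<open>w * (w - 1)\<close>, fails for \<open>w = 0\<close>.\<close>
proof (cases "w = 0 \<or> n = 0")
  case True
  then show ?thesis
  proof
    assume "n = 0"
    then have "w choose 2 = 0" using assms by (simp add: binomial_eq_0)
    then show ?thesis using \<open>n = 0\<close> by (simp add: binomial_eq_0_iff)
  qed (use assms(2) in simp)
next
  case False
  have "(real w - 1)\<^sup>2 \<le> real w * (real w - 1)"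
    using False by (simp add: power2_eq_square mult_right_mono)
  also have "\<dots> \<le> \<epsilon> * (real n * (real n - 1))" using assms(1) by (simp add: real_choose_two)
  also have "\<dots> \<le> \<epsilon> * (real n)\<^sup>2"
    using assms(2) by (intro mult_left_mono) (simp_all add: power2_eq_square mult_left_mono)
  also have "\<dots> = (sqrt \<epsilon> * real n)\<^sup>2" using assms(2) by (simp add: power_mult_distrib)
  finally have "real w - 1 \<le> sqrt \<epsilon> * real n"
    by (rule power2_le_imp_le) (use assms(2) in simp)
  then show ?thesis by simp
qed

text \<open>The choice of \<open>m\<close> keeps the exponent positive for all \<open>\<epsilon> < 1\<close>, and at least \<open>1/4\<close> as
  \<open>\<epsilon> \<rightarrow> 0\<close>, where the base tends to infinity.\<close>

definition partition_growth :: "real \<Rightarrow> real" where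
  "partition_growth \<epsilon> = (let m = max 1 (nat \<lfloor>1 / (2 * sqrt \<epsilon>)\<rfloor>)
     in real (Suc m) powr ((1 - real m * sqrt \<epsilon>) / 2))"

text \<open>Either \<open>m = 1\<close> and \<open>sqrt \<epsilon> < 1\<close>, or \<open>m\<close>
  is the floor itself and the product is at most 1/2.\<close>

lemma partition_growth_base:
  assumes "0 < \<epsilon>" "\<epsilon> < 1"
  shows "real (max 1 (nat \<lfloor>1 / (2 * sqrt \<epsilon>)\<rfloor>)) * sqrt \<epsilon> < 1"
proof (cases "nat \<lfloor>1 / (2 * sqrt \<epsilon>)\<rfloor> \<le> 1")
  case True
  then show ?thesis using assms by (simp add: max_def)
next
  case False
  have "real (nat \<lfloor>1 / (2 * sqrt \<epsilon>)\<rfloor>) * sqrt \<epsilon> \<le> 1 / (2 * sqrt \<epsilon>) * sqrt \<epsilon>"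
    using assms by (intro mult_right_mono) auto
  also have "\<dots> < 1" using assms by simp
  finally show ?thesis using False by (simp add: max_def)
qed

lemma partition_growth_gt_1:
  assumes "0 < \<epsilon>" "\<epsilon> < 1"
  shows "1 < partition_growth \<epsilon>"
  using partition_growth_base[OF assms] unfolding partition_growth_def Let_def
  by (intro gr_one_powr) auto

lemma filterlim_partition_growth: "filterlim partition_growth at_top (at_right 0)"
proof (rule filterlim_at_top_mono)
  show "filterlim (\<lambda>x::real. (1 / (2 * sqrt x)) powr (1 / 4)) at_top (at_right 0)"
    by real_asymp
  \<comment> \<open>Below 1/4 the floor is at least 1, so the \<open>max\<close> in the definition
    has no effect.\<close>
  have "(1 / (2 * sqrt x)) powr (1 / 4) \<le> partition_growth x" if x: "0 < x" "x < 1 / 4" for x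
  proof -
    define m where "m = nat \<lfloor>1 / (2 * sqrt x)\<rfloor>"
    have s: "0 < sqrt x" "sqrt x < 1 / 2"
      using x real_sqrt_less_mono[of x "1/4"] by (auto simp: real_sqrt_divide)
    then have "1 \<le> 1 / (2 * sqrt x)" by (simp add: field_simps)
    then have m1: "1 \<le> m" unfolding m_def by linarith
    have up: "1 / (2 * sqrt x) \<le> real (Suc m)" and low: "real m \<le> 1 / (2 * sqrt x)"
      using s unfolding m_def by (simp_all, linarith)
    have "real m * sqrt x \<le> 1 / 2" using low s by (simp add: field_simps)
    have "(1 / (2 * sqrt x)) powr (1 / 4) \<le> real (Suc m) powr (1 / 4)"
      using up s by (intro powr_mono2) auto
    also have "\<dots> \<le> real (Suc m) powr ((1 - real m * sqrt x) / 2)"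
      using \<open>real m * sqrt x \<le> 1 / 2\<close> by (intro powr_mono) auto
    also have "\<dots> = partition_growth x"
      using m1 by (simp add: partition_growth_def m_def[symmetric] max_def)
    finally show ?thesis .
  qed
  moreover have "eventually (\<lambda>x::real. 0 < x \<and> x < 1 / 4) (at_right 0)"
    using eventually_at_right_real[of 0 "1/4"] by simp
  ultimately show "eventually (\<lambda>x. (1 / (2 * sqrt x)) powr (1 / 4) \<le> partition_growth x) (at_right 0)"
    by (auto elim: eventually_mono)
qed

text \<open>With \<open>w\<close> at most \<open>sqrt \<epsilon> * n + 1\<close>, the exponent
  \<open>n - m * w\<close> is at least \<open>t * n - m\<close>; halving \<open>t\<close> absorbs
  the constant \<open>m\<close> and makes the inequality strict. The threshold for \<open>n\<close>
  must be uniform in \<open>w\<close> and \<open>g\<close>, since these come from an extremal poset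
  that depends on \<open>n\<close>.\<close>

lemma prod_fact_partition_gt:
  assumes "0 < \<epsilon>" "\<epsilon> < 1"
  shows "\<forall>\<^sub>F n in sequentially. \<forall>w (g :: nat \<Rightarrow> nat).
    real (w choose 2) \<le> \<epsilon> * real (n choose 2) \<longrightarrow> g ` {..<n} \<subseteq> {..<w} \<longrightarrow>
    partition_growth \<epsilon> ^ n < real (\<Prod>i<w. fact (card {x\<in>{..<n}. g x = i}))"
proof -
  define m where "m = max 1 (nat \<lfloor>1 / (2 * sqrt \<epsilon>)\<rfloor>)"
  define t where "t = 1 - real m * sqrt \<epsilon>"
  have t: "0 < t" using partition_growth_base[OF assms] by (simp add: t_def m_def)
  have \<phi>: "partition_growth \<epsilon> = real (Suc m) powr (t / 2)"
    by (simp only: partition_growth_def m_def t_def Let_def)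
  have m1: "1 \<le> m" by (simp add: m_def)
  have "\<forall>\<^sub>F n in sequentially. real m < t / 2 * real n"
    using t by real_asymp
  then show ?thesis
  proof eventually_elim
    case (elim n)
    show ?case
    proof (intro allI impI)
      fix w and g :: "nat \<Rightarrow> nat"
      assume w: "real (w choose 2) \<le> \<epsilon> * real (n choose 2)" and g: "g ` {..<n} \<subseteq> {..<w}"
      let ?P = "\<Prod>i<w. fact (card {x\<in>{..<n}. g x = i}) :: nat"
      have "real w \<le> sqrt \<epsilon> * real n + 1" using le_sqrt_of_choose_two_le[OF w] assms by simp
      then have "real m * real w \<le> real m * (sqrt \<epsilon> * real n + 1)" by (intro mult_left_mono) auto
      then have exp: "t / 2 * real n < real n - real (m * w)"
        using elim by (simp add: t_def field_simps)
      have "partition_growth \<epsilon> ^ n = real (Suc m) powr (t / 2 * real n)"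
        unfolding \<phi> by (simp add: powr_realpow[symmetric] powr_powr)
      also have "\<dots> < real (Suc m) powr (real n - real (m * w))"
        using exp m1 by (intro powr_less_mono) auto
      also have "\<dots> = real (Suc m) ^ n / real (Suc m) ^ (m * w)"
        by (simp only: powr_diff powr_realpow of_nat_0_less_iff zero_less_Suc)
      also have "\<dots> \<le> real ?P"
      proof -
        have "Suc m ^ n \<le> ?P * Suc m ^ (m * w)"
          using Suc_power_le_prod_fact[of "{..<w}" m "\<lambda>i. card {x\<in>{..<n}. g x = i}"]
            sum_card_fibres[of "{..<n}" "{..<w}" g] g by simp
        then have "real (Suc m ^ n) \<le> real (?P * Suc m ^ (m * w))" by (simp only: of_nat_le_iff)
        then show ?thesis by (simp add: divide_le_eq del: of_nat_Suc of_nat_prod)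
      qed
      finally show "partition_growth \<epsilon> ^ n < real ?P" .
    qed
  qed
qed

section \<open>Dilworth and Mirsky in terms of pair counts\<close>

lemma partial_order_on_num_linear_extensions_upper:
  assumes "finite A" "partial_order_on A r"
  obtains w and g :: "'a \<Rightarrow> nat" where "(w choose 2) + num_comparable_pairs r \<le> card A choose 2"
    "g ` A \<subseteq> {..<w}"
    "num_linear_extensions A r * (\<Prod>i<w. fact (card {x\<in>A. g x = i})) \<le> fact (card A)"
proof -
  have r: "r \<subseteq> A \<times> A" "refl_on A r" "trans r" "antisym r"
    using assms(2) by (auto simp: order_on_defs)
  have "\<exists>W (g :: 'a \<Rightarrow> nat). W \<subseteq> A \<and> (\<forall>x\<in>W. \<forall>y\<in>W. (x, y) \<in> r \<longrightarrow> x = y) \<and>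
    g ` A \<subseteq> {..<card W} \<and> (\<forall>x\<in>A. \<forall>y\<in>A. g x = g y \<longrightarrow> (x, y) \<in> r \<or> (y, x) \<in> r)"
    using assms(1) r by (intro dilworth) (auto simp: refl_on_def)
  then obtain W and g :: "'a \<Rightarrow> nat" where W: "W \<subseteq> A" "\<forall>x\<in>W. \<forall>y\<in>W. (x, y) \<in> r \<longrightarrow> x = y"
    "g ` A \<subseteq> {..<card W}" "\<forall>x\<in>A. \<forall>y\<in>A. g x = g y \<longrightarrow> (x, y) \<in> r \<or> (y, x) \<in> r"
    by (elim exE conjE)
  have "Restr r A = r" using r(1) by blast
  then have "num_linear_extensions A r * (\<Prod>i<card W. fact (card {x\<in>A. g x = i})) \<le> fact (card A)"
    using num_linear_extensions_chain_partition[OF assms(1) finite_lessThan W(3), of r] W(4) by simp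
  moreover have "(card W choose 2) + num_comparable_pairs r \<le> card A choose 2"
    using W(2) by (intro antichain_choose_two_le_incomparable_pairs[OF assms(1) r(1) W(1)]) blast
  ultimately show ?thesis using that W(3) by blast
qed

lemma partial_order_on_num_linear_extensions_lower:
  assumes "finite A" "partial_order_on A r"
  obtains w and g :: "'a \<Rightarrow> nat" where "w choose 2 \<le> num_comparable_pairs r"
    "g ` A \<subseteq> {..<w}"
    "(\<Prod>i<w. fact (card {x\<in>A. g x = i})) \<le> num_linear_extensions A r"
proof -
  have r: "r \<subseteq> A \<times> A" "refl_on A r" "trans r" "antisym r"
    using assms(2) by (auto simp: order_on_defs)
  have refl: "\<forall>x\<in>A. (x, x) \<in> r" using r(2) by (auto simp: refl_on_def)
  obtain C and h :: "'a \<Rightarrow> nat" where C: "C \<subseteq> A"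
    "\<And>x y. x \<in> C \<Longrightarrow> y \<in> C \<Longrightarrow> (x, y) \<in> r \<or> (y, x) \<in> r"
    and h: "h ` A \<subseteq> {..<card C}"
    "\<And>x y. x \<in> A \<Longrightarrow> y \<in> A \<Longrightarrow> (x, y) \<in> r \<Longrightarrow> x \<noteq> y \<Longrightarrow> h x < h y"
    using mirsky[OF assms(1) r(3,4) refl] by metis
  have "Restr r A = r" using r(1) by blast
  moreover have "(\<Prod>i<card C. fact (card {x\<in>A. h x = i})) \<le> num_linear_extensions A (Restr r A)"
    using assms(1) h by (intro num_linear_extensions_antichain_partition) auto
  ultimately show ?thesis
    using that[OF chain_choose_two_le_num_comparable_pairs[OF assms(1) r(1) C] h(1)] by simp
qed

subsection \<open>Partitions into large blocks\<close>

text \<open>The multinomial coefficient times the monomial in the \<open>p i\<close> is a single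
  nonnegative term in the expansion of a power of their sum. The weights \<open>p\<close> can be
  chosen freely to bound the coefficient.\<close>

lemma fact_sum_mult_prod_power_le:
  fixes p :: "'i \<Rightarrow> real" and a :: "'i \<Rightarrow> nat"
  assumes "finite I" "\<And>i. i \<in> I \<Longrightarrow> 0 \<le> p i"
  shows "fact (\<Sum>i\<in>I. a i) * (\<Prod>i\<in>I. p i ^ a i) \<le> (\<Sum>i\<in>I. p i) ^ (\<Sum>i\<in>I. a i) * (\<Prod>i\<in>I. fact (a i))"
  using assms
proof (induction I rule: finite_induct)
  case (insert j I)
  let ?m = "\<Sum>i\<in>I. a i" and ?s = "\<Sum>i\<in>I. p i" and ?P = "\<Prod>i\<in>I. p i ^ a i"
    and ?F = "\<Prod>i\<in>I. fact (a i) :: real"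
  have s: "0 \<le> ?s" "0 \<le> p j" using insert.prems by (auto intro: sum_nonneg)
  have "fact (a j) * fact ?m * ((a j + ?m) choose (a j)) = fact (a j + ?m)"
    using binomial_fact_lemma[of "a j" "a j + ?m"] by simp
  then have "real (fact (a j) * fact ?m * ((a j + ?m) choose (a j))) = real (fact (a j + ?m))"
    by (simp only:)
  then have "fact (a j + ?m) = fact (a j) * fact ?m * real ((a j + ?m) choose (a j))"
    by simp
  then have "fact (a j + ?m) * (p j ^ a j * ?P) =
      fact (a j) * real ((a j + ?m) choose (a j)) * p j ^ a j * (fact ?m * ?P)"
    by (simp add: algebra_simps)
  also have "\<dots> \<le> fact (a j) * real ((a j + ?m) choose (a j)) * p j ^ a j * (?s ^ ?m * ?F)"
    using insert s by (intro mult_left_mono) auto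
  also have "\<dots> = real ((a j + ?m) choose (a j)) * p j ^ a j * ?s ^ (a j + ?m - a j) * (fact (a j) * ?F)"
    by (simp add: algebra_simps)
  \<comment> \<open>The left side is the term \<open>k = a j\<close> of the binomial
    expansion.\<close>
  also have "\<dots> \<le> (\<Sum>k\<le>a j + ?m. real ((a j + ?m) choose k) * p j ^ k * ?s ^ (a j + ?m - k)) * (fact (a j) * ?F)"
    using s by (intro mult_right_mono member_le_sum[where i = "a j"])
      (auto intro!: mult_nonneg_nonneg prod_nonneg)
  also have "\<dots> = (p j + ?s) ^ (a j + ?m) * (fact (a j) * ?F)"
    by (simp add: binomial_ring)
  finally show ?case using insert.hyps by simp
qed simp

text \<open>The blocks of \<open>\<lambda>x. x div b\<close> have at most \<open>b = 1 + \<lfloor>(1 - \<epsilon>)(n - 1)\<rfloor>\<close> elements, so that each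
  point shares its block with at most a fraction \<open>1 - \<epsilon>\<close> of the others.\<close>

definition block_size :: "real \<Rightarrow> nat \<Rightarrow> nat" where
  "block_size \<epsilon> n = Suc (nat \<lfloor>(1 - \<epsilon>) * (real n - 1)\<rfloor>)"

text \<open>The factor \<open>1 / (1 - \<epsilon>)\<close> bounds the sum of the weights
  \<open>\<epsilon> ^ i\<close>, and the power of \<open>\<epsilon>\<close> is the cost per point of
  the weights used. The factor \<open>1 + \<epsilon>\<close> is slack: its \<open>n\<close>-th power
  eventually beats the constant left over from rounding.\<close>

definition block_growth :: "real \<Rightarrow> real" where
  "block_growth \<epsilon> = (1 + \<epsilon>) / (1 - \<epsilon>) * \<epsilon> powr (- \<epsilon> / (1 - \<epsilon>))"

lemma block_growth_pos: "0 < \<epsilon> \<Longrightarrow> \<epsilon> < 1 \<Longrightarrow> 0 < block_growth \<epsilon>"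
  by (simp add: block_growth_def)

lemma tendsto_block_growth: "(block_growth \<longlongrightarrow> 1) (at_right 0)"
  unfolding block_growth_def by real_asymp

lemma block_size_bounds:
  assumes "0 < \<epsilon>" "\<epsilon> < 1" "0 < n"
  shows "(1 - \<epsilon>) * (real n - 1) \<le> real (block_size \<epsilon> n)"
    "real (block_size \<epsilon> n) - 1 \<le> (1 - \<epsilon>) * (real n - 1)"
    "block_size \<epsilon> n \<le> n" "real n - real (block_size \<epsilon> n) \<le> \<epsilon> * real n + 1"
proof -
  let ?y = "(1 - \<epsilon>) * (real n - 1)"
  have y: "0 \<le> ?y" using assms by simp
  show 1: "?y \<le> real (block_size \<epsilon> n)" unfolding block_size_def by simp linarith
  show 2: "real (block_size \<epsilon> n) - 1 \<le> ?y" unfolding block_size_def using y by simp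
  have "?y \<le> real n - 1" using assms by (simp add: mult_left_le_one_le)
  with 2 show "block_size \<epsilon> n \<le> n" by linarith
  have "real n - real (block_size \<epsilon> n) \<le> real n - ?y" using 1 by simp
  also have "\<dots> \<le> \<epsilon> * real n + 1" using assms by (simp add: algebra_simps)
  finally show "real n - real (block_size \<epsilon> n) \<le> \<epsilon> * real n + 1" .
qed

text \<open>The first block has index 0, so at most \<open>\<epsilon> * n + 1\<close> points
  contribute. Each contributes at most \<open>1 / (1 - \<epsilon>)\<close>, because
  \<open>x div b * b\<close> is at most \<open>n - 1\<close>, which is at most
  \<open>b / (1 - \<epsilon>)\<close>.\<close>

lemma sum_block_index_le:
  assumes "0 < \<epsilon>" "\<epsilon> < 1" "0 < n"
  shows "real (\<Sum>x<n. x div block_size \<epsilon> n) \<le> (\<epsilon> * real n + 1) / (1 - \<epsilon>)"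
proof -
  define b where "b = block_size \<epsilon> n"
  note bb = block_size_bounds[OF assms, folded b_def]
  have b0: "0 < b" by (simp add: b_def block_size_def)
  have le: "real (x div b) \<le> 1 / (1 - \<epsilon>)" if "x < n" for x
  proof -
    have "(1 - \<epsilon>) * (real (x div b) * real b) \<le> (1 - \<epsilon>) * (real n - 1)"
    proof (intro mult_left_mono)
      have "x div b * b \<le> n - 1" using that div_times_less_eq_dividend[of x b] by linarith
      then have "real (x div b * b) \<le> real (n - 1)" by (simp only: of_nat_le_iff)
      then show "real (x div b) * real b \<le> real n - 1" using assms by simp
    qed (use assms in simp)
    then have "(1 - \<epsilon>) * real (x div b) * real b \<le> 1 * real b" using bb(1) by simp
    then have "(1 - \<epsilon>) * real (x div b) \<le> 1" using b0 by (simp only: mult_le_cancel_right_pos of_nat_0_less_iff)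
    then show ?thesis using assms by (simp add: field_simps)
  qed
  have "(\<Sum>x<n. real (x div b)) = (\<Sum>x\<in>{b..<n}. real (x div b))"
    by (rule sum.mono_neutral_right) auto
  also have "\<dots> \<le> (\<Sum>x\<in>{b..<n}. 1 / (1 - \<epsilon>))"
    by (intro sum_mono le) simp
  also have "\<dots> = (real n - real b) / (1 - \<epsilon>)" using bb(3) by (simp add: of_nat_diff)
  also have "\<dots> \<le> (\<epsilon> * real n + 1) / (1 - \<epsilon>)" using bb(4) assms by (intro divide_right_mono) auto
  finally show ?thesis by (simp add: b_def)
qed

text \<open>The multinomial bound with weight \<open>\<epsilon> ^ i\<close> on block
  \<open>i\<close>: the monomial becomes \<open>\<epsilon>\<close> to the sum of all block indices.
  Indices range over \<open>{..<n}\<close> for convenience; empty blocks contribute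
  \<open>fact 0 = 1\<close>.\<close>

lemma fact_div_block_facts_le:
  assumes "0 < \<epsilon>" "\<epsilon> < 1" "0 < n"
  shows "fact n \<le> (1 / (1 - \<epsilon>)) ^ n * \<epsilon> powr (- (\<epsilon> * real n + 1) / (1 - \<epsilon>)) *
    real (\<Prod>i<n. fact (card {x\<in>{..<n}. x div block_size \<epsilon> n = i}))"
proof -
  define g where "g = (\<lambda>x. x div block_size \<epsilon> n)"
  define a where "a i = card {x\<in>{..<n}. g x = i}" for i
  have g: "g ` {..<n} \<subseteq> {..<n}" unfolding g_def using div_le_dividend le_less_trans by blast
  have sum_a: "(\<Sum>i<n. a i) = n"
    unfolding a_def using sum_card_fibres[OF _ _ g] by simp
  let ?e = "(\<epsilon> * real n + 1) / (1 - \<epsilon>)"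
  let ?F = "\<Prod>i<n. fact (a i) :: real"
  have "(\<Prod>i<n. (\<epsilon> ^ i) ^ a i) = (\<Prod>i<n. \<Prod>x\<in>{x\<in>{..<n}. g x = i}. \<epsilon> ^ g x)"
    by (simp add: a_def)
  also have "\<dots> = (\<Prod>x<n. \<epsilon> ^ g x)"
    using prod.group[OF _ _ g, of "\<lambda>x. \<epsilon> ^ g x"] by simp
  also have "\<dots> = \<epsilon> powr real (\<Sum>x<n. g x)"
    using assms by (simp add: power_sum[symmetric] powr_realpow del: of_nat_sum)
  also have "\<epsilon> powr ?e \<le> \<dots>"
    using sum_block_index_le[OF assms] assms unfolding g_def by (intro powr_mono') auto
  finally have low: "\<epsilon> powr ?e \<le> (\<Prod>i<n. (\<epsilon> ^ i) ^ a i)" .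
  have geo: "(\<Sum>i<n. \<epsilon> ^ i) \<le> 1 / (1 - \<epsilon>)"
    using assms by (simp add: sum_gp_strict divide_right_mono)
  have "fact n * \<epsilon> powr ?e \<le> fact n * (\<Prod>i<n. (\<epsilon> ^ i) ^ a i)"
    using low by (intro mult_left_mono) auto
  also have "\<dots> \<le> (\<Sum>i<n. \<epsilon> ^ i) ^ n * ?F"
    using fact_sum_mult_prod_power_le[of "{..<n}" "\<lambda>i. \<epsilon> ^ i" a] assms by (simp add: sum_a)
  also have "\<dots> \<le> (1 / (1 - \<epsilon>)) ^ n * ?F"
    using geo assms by (intro mult_right_mono power_mono sum_nonneg prod_nonneg) auto
  finally have "fact n \<le> (1 / (1 - \<epsilon>)) ^ n * ?F / \<epsilon> powr ?e"
    using assms by (simp add: pos_le_divide_eq)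
  moreover have "\<epsilon> powr (- (\<epsilon> * real n + 1) / (1 - \<epsilon>)) = 1 / \<epsilon> powr ?e"
    by (simp only: powr_minus_divide flip: minus_divide_left)
  ultimately show ?thesis
    by (simp add: a_def g_def mult.commute)
qed

lemma fact_less_block_growth:
  assumes "0 < \<epsilon>" "\<epsilon> < 1"
  shows "\<forall>\<^sub>F n in sequentially. fact n <
    block_growth \<epsilon> ^ n * real (\<Prod>i<n. fact (card {x\<in>{..<n}. x div block_size \<epsilon> n = i}))"
proof -
  \<comment> \<open>The left side is the constant coming from the \<open>+ 1\<close> in the exponent
    \<open>\<epsilon> * n + 1\<close>.\<close>
  have "\<forall>\<^sub>F n in sequentially. \<epsilon> powr (- 1 / (1 - \<epsilon>)) < (1 + \<epsilon>) ^ n"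
    using assms(1) by real_asymp
  then show ?thesis using eventually_gt_at_top[of 0]
  proof eventually_elim
    case (elim n)
    let ?F = "real (\<Prod>i<n. fact (card {x\<in>{..<n}. x div block_size \<epsilon> n = i}))"
    have F: "0 < ?F" by (simp add: prod_pos)
    have "- (\<epsilon> * real n + 1) / (1 - \<epsilon>) = - \<epsilon> / (1 - \<epsilon>) * real n + - 1 / (1 - \<epsilon>)"
      using assms by (simp add: field_simps)
    then have "\<epsilon> powr (- (\<epsilon> * real n + 1) / (1 - \<epsilon>)) =
        (\<epsilon> powr (- \<epsilon> / (1 - \<epsilon>))) ^ n * \<epsilon> powr (- 1 / (1 - \<epsilon>))"
      using assms by (simp only: powr_add powr_powr[symmetric] powr_realpow powr_gt_zero)
    also have "\<dots> < (\<epsilon> powr (- \<epsilon> / (1 - \<epsilon>))) ^ n * (1 + \<epsilon>) ^ n"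
      using elim assms by (intro mult_strict_left_mono) auto
    finally have "(1 / (1 - \<epsilon>)) ^ n * \<epsilon> powr (- (\<epsilon> * real n + 1) / (1 - \<epsilon>)) <
        (1 / (1 - \<epsilon>)) ^ n * ((\<epsilon> powr (- \<epsilon> / (1 - \<epsilon>))) ^ n * (1 + \<epsilon>) ^ n)"
      using assms by (intro mult_strict_left_mono) auto
    also have "\<dots> = block_growth \<epsilon> ^ n"
      by (simp add: block_growth_def power_mult_distrib power_divide)
    finally have "(1 / (1 - \<epsilon>)) ^ n * \<epsilon> powr (- (\<epsilon> * real n + 1) / (1 - \<epsilon>)) * ?F < block_growth \<epsilon> ^ n * ?F"
      using F by (intro mult_strict_right_mono) auto
    with fact_div_block_facts_le[OF assms elim(2)] show ?case by (rule le_less_trans)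
  qed
qed

text \<open>A point has at most \<open>b - 1\<close> partners in its block, so there are at most
  \<open>n * (b - 1) / 2\<close> such pairs. The rounding in \<open>block_size\<close> makes
  \<open>b - 1\<close> at most \<open>(1 - \<epsilon>) * (n - 1)\<close>, so the bound is exact for
  every positive \<open>n\<close>, with no error term.\<close>

lemma card_pairs_in_same_block_le:
  assumes "0 < \<epsilon>" "\<epsilon> < 1" "0 < n"
  shows "real (card {{x, y} | x y. x < n \<and> y < n \<and> x \<noteq> y \<and> x div block_size \<epsilon> n = y div block_size \<epsilon> n})
    \<le> (1 - \<epsilon>) * real (n choose 2)" (is "real (card ?E) \<le> _")
proof -
  define b where "b = block_size \<epsilon> n"
  define F where "F i = {x\<in>{..<n}. x div b = i}" for i
  have b0: "0 < b" by (simp add: b_def block_size_def)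
  have fin: "finite (F i)" for i by (simp add: F_def)
  have cardF: "card (F i) \<le> b" for i
  proof -
    have "F i \<subseteq> {i * b..<i * b + b}"
    proof
      fix x assume "x \<in> F i"
      then have "x = i * b + x mod b" by (auto simp: F_def)
      moreover have "x mod b < b" using b0 by simp
      ultimately show "x \<in> {i * b..<i * b + b}" by (metis atLeastLessThan_iff le_add1 nat_add_left_cancel_less)
    qed
    then have "card (F i) \<le> card {i * b..<i * b + b}" by (intro card_mono) auto
    then show ?thesis by simp
  qed
  have blocks: "(\<lambda>x. x div b) ` {..<n} \<subseteq> {..<n}" using div_le_dividend le_less_trans by blast
  have "?E \<subseteq> (\<Union>i<n. {e. e \<subseteq> F i \<and> card e = 2})"
  proof
    fix e assume "e \<in> ?E"
    then obtain x y where e: "e = {x, y}" "x < n" "y < n" "x \<noteq> y" "x div b = y div b"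
      by (auto simp: b_def)
    then have "e \<subseteq> F (x div b)" "card e = 2" by (auto simp: F_def)
    moreover have "x div b < n" using e(2) div_le_dividend le_less_trans by blast
    ultimately show "e \<in> (\<Union>i<n. {e. e \<subseteq> F i \<and> card e = 2})" by auto
  qed
  then have "card ?E \<le> card (\<Union>i<n. {e. e \<subseteq> F i \<and> card e = 2})"
    using fin by (intro card_mono) auto
  also have "\<dots> \<le> (\<Sum>i<n. card {e. e \<subseteq> F i \<and> card e = 2})" by (rule card_UN_le) simp
  also have "\<dots> = (\<Sum>i<n. card (F i) choose 2)" using fin by (simp add: n_subsets)
  finally have "real (card ?E) \<le> (\<Sum>i<n. real (card (F i) choose 2))"
    by (simp flip: of_nat_sum)
  also have "\<dots> \<le> (\<Sum>i<n. real (card (F i)) * ((real b - 1) / 2))"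
  proof (rule sum_mono)
    fix i
    have "real (card (F i)) * (real (card (F i)) - 1) \<le> real (card (F i)) * (real b - 1)"
      using cardF[of i] by (intro mult_left_mono) auto
    then show "real (card (F i) choose 2) \<le> real (card (F i)) * ((real b - 1) / 2)" by (simp add: real_choose_two)
  qed
  also have "\<dots> = real (\<Sum>i<n. card (F i)) * ((real b - 1) / 2)"
    by (simp add: sum_distrib_right)
  also have "\<dots> = real n * ((real b - 1) / 2)"
    unfolding F_def using sum_card_fibres[OF _ _ blocks] by simp
  also have "\<dots> \<le> real n * ((1 - \<epsilon>) * (real n - 1) / 2)"
    using block_size_bounds(2)[OF assms] unfolding b_def by (intro mult_left_mono divide_right_mono) auto
  finally show ?thesis by (simp add: real_choose_two mult_ac)
qed

subsection \<open>Bounds on the extremal functions\<close>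

lemma f_plus_ge:
  assumes "partial_order_on {..<n} r" "\<delta> * real (n choose 2) \<le> real (num_comparable_pairs r)"
  shows "num_linear_extensions {..<n} r \<le> f_plus n \<delta>"
  unfolding f_plus_def by (rule Max_ge[OF finite_poset_values]) (use assms in blast)

lemma f_minus_le:
  assumes "partial_order_on {..<n} r" "real (num_comparable_pairs r) \<le> \<delta> * real (n choose 2)"
  shows "f_minus n \<delta> \<le> num_linear_extensions {..<n} r"
  unfolding f_minus_def by (rule Min_le[OF finite_poset_values]) (use assms in blast)

lemma f_plus_witness:
  assumes "\<delta> \<le> 1"
  obtains r where "partial_order_on {..<n} r" "\<delta> * real (n choose 2) \<le> real (num_comparable_pairs r)"
    "f_plus n \<delta> = num_linear_extensions {..<n} r"
  using Max_in[OF finite_poset_values f_plus_set_nonempty[OF assms, of n]]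
  unfolding f_plus_def by auto

lemma f_minus_witness:
  assumes "0 \<le> \<delta>"
  obtains r where "partial_order_on {..<n} r" "real (num_comparable_pairs r) \<le> \<delta> * real (n choose 2)"
    "f_minus n \<delta> = num_linear_extensions {..<n} r"
  using Min_in[OF finite_poset_values f_minus_set_nonempty[OF assms, of n]]
  unfolding f_minus_def by auto

lemma f_plus_upper:
  assumes "0 < \<delta>" "\<delta> < 1"
  shows "\<forall>\<^sub>F n in sequentially. root n (real (f_plus n \<delta>) / fact n) < 1 / partition_growth (1 - \<delta>)"
proof -
  let ?\<phi> = "partition_growth (1 - \<delta>)"
  have \<phi>: "1 < ?\<phi>" using assms by (intro partition_growth_gt_1) auto
  have "\<forall>\<^sub>F n in sequentially. \<forall>w (g :: nat \<Rightarrow> nat).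
    real (w choose 2) \<le> (1 - \<delta>) * real (n choose 2) \<longrightarrow> g ` {..<n} \<subseteq> {..<w} \<longrightarrow>
    ?\<phi> ^ n < real (\<Prod>i<w. fact (card {x\<in>{..<n}. g x = i}))"
    using assms by (intro prod_fact_partition_gt) auto
  then show ?thesis using eventually_gt_at_top[of 0]
  proof eventually_elim
    case (elim n)
    obtain r where r: "partial_order_on {..<n} r"
      "\<delta> * real (n choose 2) \<le> real (num_comparable_pairs r)"
      "f_plus n \<delta> = num_linear_extensions {..<n} r"
      using f_plus_witness assms by (metis less_imp_le)
    obtain w and g :: "nat \<Rightarrow> nat" where w: "(w choose 2) + num_comparable_pairs r \<le> card {..<n} choose 2"
      and g: "g ` {..<n} \<subseteq> {..<w}"
      and e: "num_linear_extensions {..<n} r * (\<Prod>i<w. fact (card {x\<in>{..<n}. g x = i})) \<le> fact (card {..<n})"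
      using partial_order_on_num_linear_extensions_upper[OF finite_lessThan r(1)] by blast
    let ?P = "real (\<Prod>i<w. fact (card {x\<in>{..<n}. g x = i}))"
    have "real ((w choose 2) + num_comparable_pairs r) \<le> real (n choose 2)"
      using w by (simp only: of_nat_le_iff card_lessThan)
    \<comment> \<open>At most a fraction \<open>1 - \<delta>\<close> of all pairs is incomparable,
      and an antichain of size \<open>w\<close> consumes \<open>w choose 2\<close> of them.\<close>
    then have "real (w choose 2) \<le> (1 - \<delta>) * real (n choose 2)"
      using r(2) by (simp add: algebra_simps)
    with elim(1) g have P: "?\<phi> ^ n < ?P" by blast
    have P0: "0 < ?P" by (simp add: prod_pos)
    have "real (f_plus n \<delta> * (\<Prod>i<w. fact (card {x\<in>{..<n}. g x = i}))) \<le> real (fact n)"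
      using e r(3) by (simp only: of_nat_le_iff card_lessThan)
    then have "real (f_plus n \<delta>) / fact n \<le> 1 / ?P"
      using P0 by (simp add: field_simps del: of_nat_prod)
    also have "\<dots> < 1 / ?\<phi> ^ n" using P P0 \<phi> by (intro divide_strict_left_mono mult_pos_pos) (simp_all del: of_nat_prod)
    also have "\<dots> = (1 / ?\<phi>) ^ n" by (simp add: power_one_over)
    finally have "root n (real (f_plus n \<delta>) / fact n) < root n ((1 / ?\<phi>) ^ n)"
      using elim(2) by (rule real_root_less_mono[rotated])
    then show ?case using elim(2) \<phi> by (simp add: real_root_power_cancel)
  qed
qed

lemma f_minus_lower:
  assumes "0 < \<delta>" "\<delta> < 1"
  shows "\<forall>\<^sub>F n in sequentially. partition_growth \<delta> < root n (real (f_minus n \<delta>))"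
  using prod_fact_partition_gt[OF assms] eventually_gt_at_top[of 0]
proof eventually_elim
  case (elim n)
  obtain r where r: "partial_order_on {..<n} r"
    "real (num_comparable_pairs r) \<le> \<delta> * real (n choose 2)"
    "f_minus n \<delta> = num_linear_extensions {..<n} r"
    using f_minus_witness assms by (metis less_imp_le)
  obtain w and g :: "nat \<Rightarrow> nat" where w: "w choose 2 \<le> num_comparable_pairs r"
    and g: "g ` {..<n} \<subseteq> {..<w}"
    and e: "(\<Prod>i<w. fact (card {x\<in>{..<n}. g x = i})) \<le> num_linear_extensions {..<n} r"
    using partial_order_on_num_linear_extensions_lower[OF finite_lessThan r(1)] by blast
  have "real (w choose 2) \<le> \<delta> * real (n choose 2)"
    using w r(2) by linarith
  with elim(1) g have "partition_growth \<delta> ^ n < real (\<Prod>i<w. fact (card {x\<in>{..<n}. g x = i}))"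
    by blast
  also have "\<dots> \<le> real (f_minus n \<delta>)" using e r(3) by (simp only: of_nat_le_iff)
  finally have "root n (partition_growth \<delta> ^ n) < root n (real (f_minus n \<delta>))"
    using elim(2) by (rule real_root_less_mono[rotated])
  then show ?case
    using elim(2) partition_growth_gt_1[OF assms] by (simp add: real_root_power_cancel)
qed

lemma f_plus_lower:
  assumes "0 < \<delta>" "\<delta> < 1"
  shows "\<forall>\<^sub>F n in sequentially. 1 / block_growth \<delta> < root n (real (f_plus n \<delta>) / fact n)"
  using fact_less_block_growth[OF assms] eventually_gt_at_top[of 0]
proof eventually_elim
  case (elim n)
  define g where "g = (\<lambda>x. x div block_size \<delta> n)"
  \<comment> \<open>The ordered sum of antichains: exactly the pairs within a block are
    incomparable, and these are at most a fraction \<open>1 - \<delta>\<close>.\<close>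
  define r where "r = {(x, y). x < n \<and> y < n \<and> (x = y \<or> g x < g y)}"
  let ?P = "\<Prod>i<n. fact (card {x\<in>{..<n}. g x = i}) :: nat"
  have g: "g ` {..<n} \<subseteq> {..<n}" unfolding g_def using div_le_dividend le_less_trans by blast
  have po: "partial_order_on {..<n} r"
    by (auto simp: r_def order_on_defs refl_on_def trans_def antisym_def)
  let ?E = "{{x, y} | x y. x < n \<and> y < n \<and> x \<noteq> y \<and> g x = g y}"
  have finC: "finite (comparability_edges r)"
    by (rule finite_subset[of _ "Pow {..<n}"]) (auto simp: comparability_edges_def r_def)
  have finE: "finite ?E"
    by (rule finite_subset[of _ "Pow {..<n}"]) auto
  have "{e. e \<subseteq> {..<n} \<and> card e = 2} \<subseteq> ?E \<union> comparability_edges r"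
  proof
    fix e assume "e \<in> {e. e \<subseteq> {..<n} \<and> card e = 2}"
    then obtain x y where e: "e = {x, y}" "x \<noteq> y" "x < n" "y < n" by (auto simp: card_2_iff)
    have "e = {y, x}" using e by auto
    consider "g x = g y" | "g x < g y" | "g y < g x" by linarith
    then show "e \<in> ?E \<union> comparability_edges r"
    proof cases
      case 1
      then show ?thesis using e by blast
    next
      case 2
      then have "(x, y) \<in> r" using e by (simp add: r_def)
      then show ?thesis using e unfolding comparability_edges_def by blast
    next
      case 3
      then have "(y, x) \<in> r" using e by (simp add: r_def)
      then show ?thesis using e \<open>e = {y, x}\<close> unfolding comparability_edges_def by blast
    qed
  qed
  then have "card {e. e \<subseteq> {..<n} \<and> card e = 2} \<le> card (?E \<union> comparability_edges r)"
    using finC finE by (intro card_mono) auto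
  also have "\<dots> \<le> card ?E + num_comparable_pairs r"
    unfolding num_comparable_pairs_def by (rule card_Un_le)
  finally have "n choose 2 \<le> card ?E + num_comparable_pairs r" by (simp add: n_subsets)
  then have "real (n choose 2) \<le> real (card ?E) + real (num_comparable_pairs r)"
    by (simp only: of_nat_le_iff flip: of_nat_add)
  also have "real (card ?E) \<le> (1 - \<delta>) * real (n choose 2)"
    using card_pairs_in_same_block_le[OF assms elim(2)] by (simp add: g_def)
  finally have "\<delta> * real (n choose 2) \<le> real (num_comparable_pairs r)"
    by (simp add: algebra_simps)
  then have "num_linear_extensions {..<n} r \<le> f_plus n \<delta>" by (rule f_plus_ge[OF po])
  moreover have "Restr r {..<n} = r" by (auto simp: r_def)
  moreover have "?P \<le> num_linear_extensions {..<n} (Restr r {..<n})"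
    using g by (intro num_linear_extensions_antichain_partition) (auto simp: r_def)
  ultimately have "?P \<le> f_plus n \<delta>" by simp
  then have P: "real ?P \<le> real (f_plus n \<delta>)" by (simp only: of_nat_le_iff)
  have "fact n < block_growth \<delta> ^ n * real ?P"
    using elim(1) by (simp only: g_def)
  also have "\<dots> \<le> block_growth \<delta> ^ n * real (f_plus n \<delta>)"
    using P block_growth_pos[OF assms] by (intro mult_left_mono) auto
  finally have "(1 / block_growth \<delta>) ^ n < real (f_plus n \<delta>) / fact n"
    using block_growth_pos[OF assms] by (simp add: field_simps)
  then have "root n ((1 / block_growth \<delta>) ^ n) < root n (real (f_plus n \<delta>) / fact n)"
    using elim(2) by (rule real_root_less_mono[rotated])
  then show ?case
    using elim(2) block_growth_pos[OF assms] by (simp add: real_root_power_cancel)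
qed

lemma f_minus_upper:
  assumes "0 < \<delta>" "\<delta> < 1"
  shows "\<forall>\<^sub>F n in sequentially. root n (real (f_minus n \<delta>)) < block_growth (1 - \<delta>)"
proof -
  have \<epsilon>: "0 < 1 - \<delta>" "1 - \<delta> < 1" using assms by auto
  show ?thesis
    using fact_less_block_growth[OF \<epsilon>] eventually_gt_at_top[of 0]
  proof eventually_elim
    case (elim n)
    define g where "g = (\<lambda>x. x div block_size (1 - \<delta>) n)"
    \<comment> \<open>The disjoint union of chains: exactly the pairs within a block are comparable.
      Blocks of relative size about \<open>\<delta>\<close> keep them within the allowed fraction,
      hence the parameter \<open>1 - \<delta>\<close>.\<close>
    define r where "r = {(x, y). x < n \<and> y < n \<and> g x = g y \<and> x \<le> y}"
    let ?P = "\<Prod>i<n. fact (card {x\<in>{..<n}. g x = i}) :: nat"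
    have g: "g ` {..<n} \<subseteq> {..<n}" unfolding g_def using div_le_dividend le_less_trans by blast
    have po: "partial_order_on {..<n} r"
      by (auto simp: r_def order_on_defs refl_on_def trans_def antisym_def)
    let ?E = "{{x, y} | x y. x < n \<and> y < n \<and> x \<noteq> y \<and> g x = g y}"
    have "comparability_edges r \<subseteq> ?E" by (auto simp: comparability_edges_def r_def)
    moreover have "finite ?E"
      by (rule finite_subset[of _ "Pow {..<n}"]) auto
    ultimately have "num_comparable_pairs r \<le> card ?E"
      unfolding num_comparable_pairs_def by (intro card_mono)
    moreover have "real (card ?E) \<le> \<delta> * real (n choose 2)"
      using card_pairs_in_same_block_le[OF \<epsilon> elim(2)] by (simp add: g_def)
    ultimately have "real (num_comparable_pairs r) \<le> \<delta> * real (n choose 2)" by linarith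
    then have f: "f_minus n \<delta> \<le> num_linear_extensions {..<n} r" by (rule f_minus_le[OF po])
    have "Restr r {..<n} = r" by (auto simp: r_def)
    moreover have "num_linear_extensions {..<n} (Restr r {..<n}) * ?P \<le> fact (card {..<n})"
      using g by (intro num_linear_extensions_chain_partition) (auto simp: r_def)
    ultimately have "num_linear_extensions {..<n} r * ?P \<le> fact n" by simp
    then have "f_minus n \<delta> * ?P \<le> fact n" using mult_le_mono1[OF f] le_trans by blast
    then have "real (f_minus n \<delta> * ?P) \<le> real (fact n)" by (simp only: of_nat_le_iff)
    then have "real (f_minus n \<delta>) * real ?P \<le> fact n" by simp
    also have "\<dots> < block_growth (1 - \<delta>) ^ n * real ?P"
      using elim(1) by (simp only: g_def)
    finally have "real (f_minus n \<delta>) < block_growth (1 - \<delta>) ^ n"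
      by (rule mult_right_less_imp_less) (simp only: of_nat_0_le_iff)
    then have "root n (real (f_minus n \<delta>)) < root n (block_growth (1 - \<delta>) ^ n)"
      using elim(2) by (rule real_root_less_mono[rotated])
    then show ?case
      using elim(2) block_growth_pos[OF \<epsilon>] by (simp add: real_root_power_cancel)
  qed
qed

theorem theorem1p1:
  shows
    "(\<exists>c\<^sub>1 c\<^sub>2 :: real \<Rightarrow> real.
        (\<forall>\<delta>. 0 < \<delta> \<and> \<delta> < 1 \<longrightarrow>
           0 < c\<^sub>1 \<delta> \<and> c\<^sub>2 \<delta> < 1 \<and>
           (\<forall>\<^sub>F n in sequentially.
              c\<^sub>1 \<delta> < root n (real (f_plus n \<delta>) / fact n) \<and>
              root n (real (f_plus n \<delta>) / fact n) < c\<^sub>2 \<delta>)) \<and>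
        (c\<^sub>1 \<longlongrightarrow> 1) (at_right 0) \<and>
        (c\<^sub>2 \<longlongrightarrow> 0) (at_left 1)) \<and>
     (\<exists>c\<^sub>3 c\<^sub>4 :: real \<Rightarrow> real.
        (\<forall>\<delta>. 0 < \<delta> \<and> \<delta> < 1 \<longrightarrow>
           1 < c\<^sub>3 \<delta> \<and>
           (\<forall>\<^sub>F n in sequentially.
              c\<^sub>3 \<delta> < root n (real (f_minus n \<delta>)) \<and>
              root n (real (f_minus n \<delta>)) < c\<^sub>4 \<delta>)) \<and>
        filterlim c\<^sub>3 at_top (at_right 0) \<and>
        (c\<^sub>4 \<longlongrightarrow> 1) (at_left 1))"
proof -
  \<comment> \<open>Carries the limits of both growth functions at 0 from the right over to
    \<open>\<delta>\<close> tending to 1 from the left.\<close>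
  have flip: "filterlim (\<lambda>\<delta>::real. 1 - \<delta>) (at_right 0) (at_left 1)"
    by real_asymp
  have c1: "((\<lambda>\<delta>. 1 / block_growth \<delta>) \<longlongrightarrow> 1) (at_right 0)"
    using tendsto_divide[OF tendsto_const tendsto_block_growth, of 1] by simp
  have c2: "((\<lambda>\<delta>. 1 / partition_growth (1 - \<delta>)) \<longlongrightarrow> 0) (at_left 1)"
    by (rule tendsto_divide_0[OF tendsto_const filterlim_at_top_imp_at_infinity])
      (rule filterlim_compose[OF filterlim_partition_growth flip])
  have c4: "((\<lambda>\<delta>. block_growth (1 - \<delta>)) \<longlongrightarrow> 1) (at_left 1)"
    by (rule filterlim_compose[OF tendsto_block_growth flip])
  have "0 < 1 / block_growth \<delta> \<and> 1 / partition_growth (1 - \<delta>) < 1 \<and>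
      (\<forall>\<^sub>F n in sequentially. 1 / block_growth \<delta> < root n (real (f_plus n \<delta>) / fact n) \<and>
         root n (real (f_plus n \<delta>) / fact n) < 1 / partition_growth (1 - \<delta>))"
    if "0 < \<delta> \<and> \<delta> < 1" for \<delta>
    using that f_plus_lower[of \<delta>] f_plus_upper[of \<delta>] block_growth_pos[of \<delta>]
      partition_growth_gt_1[of "1 - \<delta>"] by (simp add: eventually_conj)
  moreover have "1 < partition_growth \<delta> \<and>
      (\<forall>\<^sub>F n in sequentially. partition_growth \<delta> < root n (real (f_minus n \<delta>)) \<and>
         root n (real (f_minus n \<delta>)) < block_growth (1 - \<delta>))"
    if "0 < \<delta> \<and> \<delta> < 1" for \<delta>
    using that f_minus_lower[of \<delta>] f_minus_upper[of \<delta>] partition_growth_gt_1[of \<delta>]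
    by (simp add: eventually_conj)
  ultimately show ?thesis
    using c1 c2 c4 filterlim_partition_growth
    by (intro conjI exI[of _ "\<lambda>\<delta>. 1 / block_growth \<delta>"] exI[of _ "\<lambda>\<delta>. 1 / partition_growth (1 - \<delta>)"]
        exI[of _ partition_growth] exI[of _ "\<lambda>\<delta>. block_growth (1 - \<delta>)"] allI impI; simp only:)
qed

end
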